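(* Let $\mathbb{F}$ be $\mathbb{R}$ or $\mathbb{C}$, let $X$ be the sequence space $l_p$ over $\mathbb{F}$ for some $1\le p<\infty$, or the sequence space $c_0$ over $\mathbb{F}$, and let $w\in\mathbb{F}$ with $|w|>1$ be arbitrary. Then the weighted backward shift \[ A: D(A)\to X,\qquad D(A)\ni x=(x_k)_{k\in\mathbb{N}}\mapsto Ax:=(w^k x_{k+1})_{k\in\mathbb{N}}, \] with the domain \[ D(A):=\left\{(x_k)_{k\in\mathbb{N}}\in X \;:\; (w^k x_{k+1})_{k\in\mathbb{N}}\in X\right\}, \] is a chaotic unbounded linear operator in $X$. Moreover, provided the underlying space $X$ is complex (i.e. $\mathbb{F}=\mathbb{C}$), the spectrum of $A$ is $\sigma(A)=\mathbb{C}$, and every $\lambda\in\mathbb{C}$ is an eigenvalue of $A$ with an associated one-dimensional eigenspace.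
   Context: Conventions: $\mathbb{N}=\{1,2,\dots\}$ and $\mathbb{Z}_+=\{0,1,2,\dots\}$. Sequences are indexed by $\mathbb{N}$. The space $l_p$ carries its usual $p$-norm; $c_0$ is the space of sequences converging to $0$, equipped with the supremum norm $\|x\|_\infty=\sup_{k\in\mathbb{N}}|x_k|$. Let $A: X\supseteq D(A)\to X$ be a (bounded or unbounded) linear operator in a (real or complex) Banach space $(X,\|\cdot\|)$. Powers $A^n$ are taken with their natural domains $D(A^n)$ (with $A^0:=I$, the identity operator on $X$), and \[ C^\infty(A):=\bigcap_{n=0}^{\infty}D(A^n). \] Hypercyclic: a nonzero vector $x\in C^\infty(A)$ is called hypercyclic for $A$ if its orbit $\operatorname{orb}(x,A):=\{A^n x\}_{n\in\mathbb{Z}_+}$ is dense in $X$. The operator $A$ is called hypercyclic if it possesses a hypercyclic vector. Periodic point: a vector $x\in C^\infty(A)$ is called a periodic point for $A$ if there exists $N\in\mathbb{N}$ with $A^N x=x$. Chaotic: the operator $A$ is called chaotic if it is hypercyclic and its set of periodic points is dense in $X$. *)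

theory Defs
  imports "HOL-Analysis.Analysis" "HOL-Library.Function_Algebras"
begin

section \<open>Banach spaces on a carrier set\<close>

text \<open>
  The spaces \<open>l\<^sub>p\<close> depend on a real parameter, so they are sets of sequences with a norm function
  rather than types.
\<close>

locale normed_space_on = vector_space smul
  for smul :: "'f::real_normed_field \<Rightarrow> 'v::ab_group_add \<Rightarrow> 'v" +
  fixes X :: "'v set" and N :: "'v \<Rightarrow> real"
  assumes subspace_carrier: "subspace X"
    and norm_nonneg: "x \<in> X \<Longrightarrow> 0 \<le> N x"
    and norm_eq_0: "x \<in> X \<Longrightarrow> N x = 0 \<longleftrightarrow> x = 0"
    and norm_scale: "x \<in> X \<Longrightarrow> N (smul c x) = norm c * N x"
    and norm_triangle: "x \<in> X \<Longrightarrow> y \<in> X \<Longrightarrow> N (x + y) \<le> N x + N y"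

text \<open>
  The locale \<^locale>\<open>Metric_space\<close> demands nonnegativity and symmetry also outside the carrier, where
  nothing is known about \<open>N\<close>; hence the guard.
\<close>

definition norm_dist :: "'v::ab_group_add set \<Rightarrow> ('v \<Rightarrow> real) \<Rightarrow> 'v \<Rightarrow> 'v \<Rightarrow> real" where
  "norm_dist X N x y = (if x \<in> X \<and> y \<in> X then N (x - y) else 0)"

lemma (in normed_space_on) Metric_space_norm_dist: "Metric_space X (norm_dist X N)"
proof
  have diff: "x - y \<in> X" if "x \<in> X" "y \<in> X" for x y
    using subspace_diff[OF subspace_carrier] that by blast
  show "0 \<le> norm_dist X N x y" for x y
    by (simp add: norm_dist_def norm_nonneg diff)
  show "norm_dist X N x y = norm_dist X N y x" for x y
    using norm_scale[OF diff, of x y "-1"] by (auto simp: norm_dist_def)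
  show "norm_dist X N x y = 0 \<longleftrightarrow> x = y" if "x \<in> X" "y \<in> X" for x y
    using that norm_eq_0[OF diff] by (simp add: norm_dist_def)
  show "norm_dist X N x z \<le> norm_dist X N x y + norm_dist X N y z"
    if "x \<in> X" "y \<in> X" "z \<in> X" for x y z
    using that norm_triangle[OF diff[of x y] diff[of y z]] by (simp add: norm_dist_def)
qed

locale banach_space_on = normed_space_on +
  assumes complete: "Metric_space.mcomplete X (norm_dist X N)"

definition dense_in :: "'v::ab_group_add set \<Rightarrow> ('v \<Rightarrow> real) \<Rightarrow> 'v set \<Rightarrow> bool" where
  "dense_in X N S \<longleftrightarrow> S \<subseteq> X \<and> Metric_space.mtopology X (norm_dist X N) closure_of S = X"

section \<open>Partially defined linear operators\<close>

text \<open>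
  An operator in \<open>X\<close> is given by its domain \<open>D\<close> and a total function \<open>A\<close>; the values of \<open>A\<close>
  outside \<open>D\<close> are irrelevant.
\<close>

definition linear_operator_in ::
    "('f::field \<Rightarrow> 'v::ab_group_add \<Rightarrow> 'v) \<Rightarrow> 'v set \<Rightarrow> 'v set \<Rightarrow> ('v \<Rightarrow> 'v) \<Rightarrow> bool" where
  "linear_operator_in smul X D A \<longleftrightarrow>
     module.subspace smul D \<and> D \<subseteq> X \<and> A ` D \<subseteq> X \<and>
     (\<forall>x\<in>D. \<forall>y\<in>D. A (x + y) = A x + A y) \<and>
     (\<forall>c. \<forall>x\<in>D. A (smul c x) = smul c (A x))"

definition bounded_on :: "('v \<Rightarrow> real) \<Rightarrow> 'v set \<Rightarrow> ('v \<Rightarrow> 'v) \<Rightarrow> bool" where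
  "bounded_on N D A \<longleftrightarrow> (\<exists>C. \<forall>x\<in>D. N (A x) \<le> C * N x)"

primrec power_domain :: "'v set \<Rightarrow> 'v set \<Rightarrow> ('v \<Rightarrow> 'v) \<Rightarrow> nat \<Rightarrow> 'v set" where
  "power_domain X D A 0 = X"
| "power_domain X D A (Suc n) = {x \<in> power_domain X D A n. (A ^^ n) x \<in> D}"

definition C_infinity :: "'v set \<Rightarrow> 'v set \<Rightarrow> ('v \<Rightarrow> 'v) \<Rightarrow> 'v set" where
  "C_infinity X D A = (\<Inter>n. power_domain X D A n)"

definition orb :: "('v \<Rightarrow> 'v) \<Rightarrow> 'v \<Rightarrow> 'v set" where
  "orb A x = range (\<lambda>n. (A ^^ n) x)"

definition hypercyclic_vector ::
    "'v::ab_group_add set \<Rightarrow> ('v \<Rightarrow> real) \<Rightarrow> 'v set \<Rightarrow> ('v \<Rightarrow> 'v) \<Rightarrow> 'v \<Rightarrow> bool" where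
  "hypercyclic_vector X N D A x \<longleftrightarrow> x \<in> C_infinity X D A \<and> x \<noteq> 0 \<and> dense_in X N (orb A x)"

definition hypercyclic ::
    "'v::ab_group_add set \<Rightarrow> ('v \<Rightarrow> real) \<Rightarrow> 'v set \<Rightarrow> ('v \<Rightarrow> 'v) \<Rightarrow> bool" where
  "hypercyclic X N D A \<longleftrightarrow> (\<exists>x. hypercyclic_vector X N D A x)"

definition periodic_points :: "'v set \<Rightarrow> 'v set \<Rightarrow> ('v \<Rightarrow> 'v) \<Rightarrow> 'v set" where
  "periodic_points X D A = {x \<in> C_infinity X D A. \<exists>m\<ge>1. (A ^^ m) x = x}"

definition chaotic ::
    "'v::ab_group_add set \<Rightarrow> ('v \<Rightarrow> real) \<Rightarrow> 'v set \<Rightarrow> ('v \<Rightarrow> 'v) \<Rightarrow> bool" where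
  "chaotic X N D A \<longleftrightarrow> hypercyclic X N D A \<and> dense_in X N (periodic_points X D A)"

definition resolvent_set ::
    "('f \<Rightarrow> 'v::ab_group_add \<Rightarrow> 'v) \<Rightarrow> 'v set \<Rightarrow> ('v \<Rightarrow> real) \<Rightarrow> 'v set \<Rightarrow> ('v \<Rightarrow> 'v) \<Rightarrow> 'f set" where
  "resolvent_set smul X N D A =
     {l. bij_betw (\<lambda>x. A x - smul l x) D X \<and>
         bounded_on N X (the_inv_into D (\<lambda>x. A x - smul l x))}"

definition spectrum ::
    "('f \<Rightarrow> 'v::ab_group_add \<Rightarrow> 'v) \<Rightarrow> 'v set \<Rightarrow> ('v \<Rightarrow> real) \<Rightarrow> 'v set \<Rightarrow> ('v \<Rightarrow> 'v) \<Rightarrow> 'f set" where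
  "spectrum smul X N D A = UNIV - resolvent_set smul X N D A"

definition eigenspace :: "('f \<Rightarrow> 'v \<Rightarrow> 'v) \<Rightarrow> 'v set \<Rightarrow> ('v \<Rightarrow> 'v) \<Rightarrow> 'f \<Rightarrow> 'v set" where
  "eigenspace smul D A l = {x \<in> D. A x = smul l x}"

definition eigenvalue ::
    "('f \<Rightarrow> 'v::zero \<Rightarrow> 'v) \<Rightarrow> 'v set \<Rightarrow> ('v \<Rightarrow> 'v) \<Rightarrow> 'f \<Rightarrow> bool" where
  "eigenvalue smul D A l \<longleftrightarrow> (\<exists>x \<in> eigenspace smul D A l. x \<noteq> 0)"

section \<open>The sequence spaces and the weighted backward shift\<close>

text \<open>
  A sequence \<open>(x\<^sub>k)\<close> indexed by \<open>k = 1, 2, \<dots>\<close> is represented by a function \<open>x\<close> on \<open>nat\<close> whose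
  value \<open>x k\<close> is the term with index \<open>k + 1\<close>.
\<close>

definition seq_scale :: "'a::times \<Rightarrow> (nat \<Rightarrow> 'a) \<Rightarrow> nat \<Rightarrow> 'a" where
  "seq_scale c x = (\<lambda>k. c * x k)"

definition lp :: "real \<Rightarrow> (nat \<Rightarrow> 'a::real_normed_vector) set" where
  "lp p = {x. summable (\<lambda>k. norm (x k) powr p)}"

definition lp_norm :: "real \<Rightarrow> (nat \<Rightarrow> 'a::real_normed_vector) \<Rightarrow> real" where
  "lp_norm p x = (\<Sum>k. norm (x k) powr p) powr (1 / p)"

definition c0 :: "(nat \<Rightarrow> 'a::real_normed_vector) set" where
  "c0 = {x. x \<longlonglongrightarrow> 0}"

definition sup_norm :: "(nat \<Rightarrow> 'a::real_normed_vector) \<Rightarrow> real" where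
  "sup_norm x = (SUP k. norm (x k))"

definition lp_or_c0 ::
    "(nat \<Rightarrow> 'a::real_normed_vector) set \<Rightarrow> ((nat \<Rightarrow> 'a) \<Rightarrow> real) \<Rightarrow> bool" where
  "lp_or_c0 X N \<longleftrightarrow> (\<exists>p\<ge>1. X = lp p \<and> N = lp_norm p) \<or> (X = c0 \<and> N = sup_norm)"

text \<open>The term of \<open>A x\<close> with index \<open>k + 1\<close> is \<open>w\<^bsup>k+1\<^esup> x\<^bsub>k+2\<^esub>\<close>.\<close>

definition wshift :: "'a::monoid_mult \<Rightarrow> (nat \<Rightarrow> 'a) \<Rightarrow> nat \<Rightarrow> 'a" where
  "wshift w x = (\<lambda>k. w ^ Suc k * x (Suc k))"

definition wshift_domain :: "'a::monoid_mult \<Rightarrow> (nat \<Rightarrow> 'a) set \<Rightarrow> (nat \<Rightarrow> 'a) set" where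
  "wshift_domain w X = {x \<in> X. wshift w x \<in> X}"

section \<open>The sequence spaces are Banach spaces\<close>

lemma vector_space_seq_scale: "vector_space (seq_scale :: 'a::field \<Rightarrow> _)"
  by unfold_locales (auto simp: seq_scale_def fun_eq_iff algebra_simps)

lemma convex_powr_nonneg:
  fixes u v t p :: real
  assumes "p \<ge> 1" "u \<ge> 0" "v \<ge> 0" "0 \<le> t" "t \<le> 1"
  shows "(t * u + (1 - t) * v) powr p \<le> t * u powr p + (1 - t) * v powr p"
proof -
  have aux: "(s * z) powr p \<le> s * z powr p" if "0 \<le> s" "s \<le> 1" "z \<ge> 0" for s z :: real
  proof (cases "s = 0")
    case False
    have "s powr p \<le> s powr 1"
      using that False assms by (intro powr_mono') auto
    then have "s powr p \<le> s" using that False by simp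
    then show ?thesis using that by (simp add: powr_mult mult_right_mono)
  qed auto
  show ?thesis
  proof (cases "u = 0 \<or> v = 0")
    case True
    then show ?thesis using aux[of t u] aux[of "1 - t" v] assms by auto
  next
    case False
    then show ?thesis
      using convex_onD[OF powr_convex[OF assms(1)], of "1 - t" u v] assms
      by (simp add: algebra_simps)
  qed
qed

lemma lp_norm_nonneg: "lp_norm p x \<ge> 0"
  by (simp add: lp_norm_def)

lemma lp_norm_powr:
  assumes "p \<ge> 1" "x \<in> lp p"
  shows "lp_norm p x powr p = (\<Sum>k. norm (x k) powr p)"
  using assms suminf_nonneg[of "\<lambda>k. norm (x k) powr p"]
  by (simp add: lp_norm_def lp_def powr_powr)

lemma lp_normI:
  assumes p: "p \<ge> 1" and e: "e \<ge> 0"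
    and le: "\<And>K. (\<Sum>k<K. norm (x k) powr p) \<le> e powr p"
  shows "x \<in> lp p" "lp_norm p x \<le> e"
proof -
  show x: "x \<in> lp p"
    unfolding lp_def mem_Collect_eq
    by (rule bounded_imp_summable[where B = "e powr p"])
      (use le in \<open>auto simp only: lessThan_Suc_atMost[symmetric] powr_ge_zero\<close>)
  have "(\<Sum>k. norm (x k) powr p) \<le> e powr p"
    using x le by (intro suminf_le_const) (auto simp: lp_def)
  then have "lp_norm p x \<le> (e powr p) powr (1 / p)"
    unfolding lp_norm_def using p x
    by (intro powr_mono2) (auto intro!: suminf_nonneg simp: lp_def)
  then show "lp_norm p x \<le> e" using p e by (simp add: powr_powr)
qed

lemma lp_norm_sum_le:
  assumes "p \<ge> 1" "x \<in> lp p" "lp_norm p x \<le> e"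
  shows "(\<Sum>k<K. norm (x k) powr p) \<le> e powr p"
proof -
  have "(\<Sum>k<K. norm (x k) powr p) \<le> (\<Sum>k. norm (x k) powr p)"
    using assms by (intro sum_le_suminf) (auto simp: lp_def)
  also have "\<dots> = lp_norm p x powr p" using assms by (simp add: lp_norm_powr)
  also have "\<dots> \<le> e powr p" using assms by (intro powr_mono2) (auto simp: lp_norm_nonneg)
  finally show ?thesis .
qed

lemma norm_le_lp_norm:
  assumes p: "p \<ge> 1" and "x \<in> lp p"
  shows "norm (x k) \<le> lp_norm p x"
proof -
  have "norm (x k) powr p \<le> (\<Sum>j<Suc k. norm (x j) powr p)"
    by (simp add: sum_nonneg)
  also have "\<dots> \<le> lp_norm p x powr p" using assms by (intro lp_norm_sum_le) auto
  finally show ?thesis using p powr_less_mono2[of p "lp_norm p x" "norm (x k)"]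
    by (force simp: lp_norm_nonneg)
qed

lemma lp_norm_eq_0:
  assumes "p \<ge> 1" "x \<in> lp p"
  shows "lp_norm p x = 0 \<longleftrightarrow> x = 0"
proof
  assume "lp_norm p x = 0"
  then show "x = 0" using norm_le_lp_norm[OF assms] by (auto simp: fun_eq_iff)
qed (use assms in \<open>auto simp: lp_norm_def\<close>)

lemma lp_add:
  fixes x y :: "nat \<Rightarrow> 'a::real_normed_vector"
  assumes p: "p \<ge> 1" and x: "x \<in> lp p" and y: "y \<in> lp p"
  shows "x + y \<in> lp p" "lp_norm p (x + y) \<le> lp_norm p x + lp_norm p y"
proof -
  define a b where "a = lp_norm p x" and "b = lp_norm p y"
  have ab0: "a \<ge> 0" "b \<ge> 0" by (auto simp: a_def b_def lp_norm_nonneg)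
  consider "a = 0" | "b = 0" | "a > 0" "b > 0" using ab0 by fastforce
  then have "x + y \<in> lp p \<and> lp_norm p (x + y) \<le> a + b"
  proof cases
    case 1
    then have "x = 0" using lp_norm_eq_0 p x a_def by metis
    then show ?thesis using ab0 y by (simp add: b_def)
  next
    case 2
    then have "y = 0" using lp_norm_eq_0 p y b_def by metis
    then show ?thesis using ab0 x by (simp add: a_def)
  next
    case 3
    define t where "t = a / (a + b)"
    have t: "0 \<le> t" "t \<le> 1" "1 - t = b / (a + b)" using 3 by (auto simp: t_def field_simps)
    have "(\<Sum>k<K. norm ((x + y) k) powr p) \<le> (a + b) powr p" for K
    proof -
      have pt: "norm ((x + y) k) powr p \<le>
          (a + b) powr p * (t * (norm (x k) powr p / a powr p) + (1 - t) * (norm (y k) powr p / b powr p))" for k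
      proof -
        have "norm ((x + y) k) \<le> norm (x k) + norm (y k)" by (simp add: norm_triangle_ineq)
        also have "\<dots> = (a + b) * (t * (norm (x k) / a) + (1 - t) * (norm (y k) / b))"
        proof -
          have "(a + b) * (t * (norm (x k) / a)) = norm (x k)"
            using 3 by (simp add: t_def)
          moreover have "(a + b) * ((1 - t) * (norm (y k) / b)) = norm (y k)"
            using 3 by (simp add: t(3))
          ultimately show ?thesis by (simp add: distrib_left)
        qed
        finally have "norm ((x + y) k) powr p \<le>
            ((a + b) * (t * (norm (x k) / a) + (1 - t) * (norm (y k) / b))) powr p"
          using p by - (rule powr_mono2, auto)
        also have "\<dots> = (a + b) powr p * (t * (norm (x k) / a) + (1 - t) * (norm (y k) / b)) powr p"
          by (rule powr_mult)
        also have "\<dots> \<le> (a + b) powr p *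
            (t * (norm (x k) / a) powr p + (1 - t) * (norm (y k) / b) powr p)"
          using 3 t p by (intro mult_left_mono convex_powr_nonneg) auto
        finally show ?thesis using 3 by (simp add: powr_divide)
      qed
      have sx: "(\<Sum>k<K. norm (x k) powr p) / a powr p \<le> 1"
        using lp_norm_sum_le[OF p x, of a K] 3 by (simp add: a_def)
      have sy: "(\<Sum>k<K. norm (y k) powr p) / b powr p \<le> 1"
        using lp_norm_sum_le[OF p y, of b K] 3 by (simp add: b_def)
      have "(\<Sum>k<K. norm ((x + y) k) powr p) \<le> (\<Sum>k<K. (a + b) powr p *
          (t * (norm (x k) powr p / a powr p) + (1 - t) * (norm (y k) powr p / b powr p)))"
        by (intro sum_mono pt)
      also have "\<dots> = (a + b) powr p * (t * ((\<Sum>k<K. norm (x k) powr p) / a powr p) +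
          (1 - t) * ((\<Sum>k<K. norm (y k) powr p) / b powr p))"
        by (simp only: sum_distrib_left[symmetric] sum.distrib sum_divide_distrib[symmetric])
      also have "\<dots> \<le> (a + b) powr p * (t * 1 + (1 - t) * 1)"
        using t sx sy by (intro mult_left_mono add_mono) auto
      finally show ?thesis by simp
    qed
    then show ?thesis using lp_normI[OF p, of "a + b" "x + y"] ab0 by auto
  qed
  then show "x + y \<in> lp p" "lp_norm p (x + y) \<le> lp_norm p x + lp_norm p y"
    by (auto simp: a_def b_def)
qed

lemma lp_scale:
  fixes x :: "nat \<Rightarrow> 'a::real_normed_field"
  assumes p: "p \<ge> 1" and x: "x \<in> lp p"
  shows "seq_scale c x \<in> lp p" "lp_norm p (seq_scale c x) = norm c * lp_norm p x"
proof -
  have eq: "(\<lambda>k. norm (seq_scale c x k) powr p) = (\<lambda>k. norm c powr p * norm (x k) powr p)"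
    by (simp add: seq_scale_def norm_mult powr_mult)
  show "seq_scale c x \<in> lp p"
    using x unfolding lp_def mem_Collect_eq eq by (intro summable_mult)
  have "lp_norm p (seq_scale c x) = (norm c powr p * (\<Sum>k. norm (x k) powr p)) powr (1 / p)"
    using x unfolding lp_norm_def eq by (subst suminf_mult) (auto simp: lp_def)
  also have "\<dots> = norm c * lp_norm p x"
    using p x by (subst powr_mult) (auto simp: powr_powr lp_norm_def lp_def intro!: suminf_nonneg)
  finally show "lp_norm p (seq_scale c x) = norm c * lp_norm p x" .
qed

lemma c0_bdd_above:
  assumes "x \<in> c0"
  shows "bdd_above (range (\<lambda>k. norm (x k)))"
proof -
  have "Bseq x" using assms convergentI convergent_imp_Bseq by (auto simp: c0_def)
  then show ?thesis by (auto simp: Bseq_def bdd_above_def)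
qed

lemma norm_le_sup_norm: "x \<in> c0 \<Longrightarrow> norm (x k) \<le> sup_norm x"
  unfolding sup_norm_def by (intro cSUP_upper c0_bdd_above) auto

lemma sup_norm_le: "(\<And>k. norm (x k) \<le> e) \<Longrightarrow> sup_norm x \<le> e"
  unfolding sup_norm_def by (intro cSUP_least) auto

lemma banach_space_onI:
  fixes X :: "(nat \<Rightarrow> 'a::{real_normed_field, banach}) set"
  assumes zero: "0 \<in> X"
    and add: "\<And>x y. x \<in> X \<Longrightarrow> y \<in> X \<Longrightarrow> x + y \<in> X"
    and smul: "\<And>c x. x \<in> X \<Longrightarrow> seq_scale c x \<in> X"
    and n0: "N 0 = 0"
    and coord: "\<And>x k. x \<in> X \<Longrightarrow> norm (x k) \<le> N x"
    and nscale: "\<And>c x. x \<in> X \<Longrightarrow> N (seq_scale c x) = norm c * N x"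
    and tri: "\<And>x y. x \<in> X \<Longrightarrow> y \<in> X \<Longrightarrow> N (x + y) \<le> N x + N y"
    and lim: "\<And>s x e m. (\<And>n. s n \<in> X) \<Longrightarrow>
       (\<And>r. r > 0 \<Longrightarrow> \<exists>m. \<forall>n n'. m \<le> n \<longrightarrow> m \<le> n' \<longrightarrow> N (s n - s n') < r) \<Longrightarrow> (\<And>k. (\<lambda>n. s n k) \<longlonglongrightarrow> x k) \<Longrightarrow> e \<ge> 0 \<Longrightarrow>
       (\<And>n. n \<ge> m \<Longrightarrow> N (s m - s n) \<le> e) \<Longrightarrow> s m - x \<in> X \<and> N (s m - x) \<le> e"
  shows "banach_space_on seq_scale X N"
proof -
  interpret vector_space "seq_scale :: 'a \<Rightarrow> _" by (rule vector_space_seq_scale)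
  have neg: "- x = seq_scale (-1) x" for x :: "nat \<Rightarrow> 'a"
    by (simp add: seq_scale_def fun_eq_iff)
  have minus: "x - y \<in> X" if "x \<in> X" "y \<in> X" for x y
    using add[OF that(1) smul[OF that(2)], of "-1"] neg[of y]
    by (metis diff_conv_add_uminus)
  interpret normed_space_on "seq_scale :: 'a \<Rightarrow> _" X N
  proof
    show "subspace X" by (auto simp: subspace_def zero add smul)
    show "0 \<le> N x" if "x \<in> X" for x
      using coord[OF that, of 0] norm_ge_zero order_trans by blast
    show "N x = 0 \<longleftrightarrow> x = 0" if "x \<in> X" for x
    proof
      assume "N x = 0"
      then show "x = 0" using coord[OF that] by (auto simp: fun_eq_iff)
    qed (simp add: n0)
  qed (use nscale tri in auto)
  interpret M: Metric_space X "norm_dist X N" by (rule Metric_space_norm_dist)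
  show ?thesis
  proof
    show "M.mcomplete"
      unfolding M.mcomplete_def
    proof (intro allI impI)
      fix s assume "M.MCauchy s"
      then have sX: "\<And>n. s n \<in> X"
        and C: "\<And>e. e > 0 \<Longrightarrow> \<exists>m. \<forall>n n'. m \<le> n \<longrightarrow> m \<le> n' \<longrightarrow> N (s n - s n') < e"
        by (auto simp: M.MCauchy_def norm_dist_def image_subset_iff)
      have "Cauchy (\<lambda>n. s n k)" for k
      proof (rule CauchyI)
        fix e :: real assume "e > 0"
        then obtain m where m: "\<And>n n'. m \<le> n \<Longrightarrow> m \<le> n' \<Longrightarrow> N (s n - s n') < e"
          using C by meson
        have "norm (s n k - s n' k) < e" if "n \<ge> m" "n' \<ge> m" for n n'
          using coord[OF minus[OF sX sX], of n n' k] m[OF that] by simp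
        then show "\<exists>M. \<forall>m\<ge>M. \<forall>n\<ge>M. norm (s m k - s n k) < e" by blast
      qed
      then have l: "(\<lambda>n. s n k) \<longlonglongrightarrow> lim (\<lambda>n. s n k)" for k
        by (simp add: Cauchy_convergent convergent_LIMSEQ_iff[symmetric])
      define x where "x = (\<lambda>k. lim (\<lambda>n. s n k))"
      have near: "\<exists>m. \<forall>n\<ge>m. s n - x \<in> X \<and> N (s n - x) < e" if "e > 0" for e
      proof -
        from that have "e / 2 > 0" by simp
        then obtain m where m: "\<And>n n'. m \<le> n \<Longrightarrow> m \<le> n' \<Longrightarrow> N (s n - s n') < e / 2"
          using C by meson
        have "s n - x \<in> X \<and> N (s n - x) \<le> e / 2" if "n \<ge> m" for n
        proof (rule lim)
          show "N (s n - s n') \<le> e / 2" if "n' \<ge> n" for n'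
            using m[of n n'] \<open>n \<ge> m\<close> that by simp
        qed (use sX C l \<open>e > 0\<close> in \<open>auto simp: x_def\<close>)
        then show ?thesis using \<open>e > 0\<close> by fastforce
      qed
      obtain m where "s m - x \<in> X" using near[of 1] by auto
      then have xX: "x \<in> X" using minus[OF sX[of m]] by fastforce
      show "\<exists>x. limitin M.mtopology s x sequentially"
        unfolding M.limit_metric_sequentially
        using xX sX near by (intro exI[of _ x]) (simp add: norm_dist_def, meson)
    qed
  qed
qed

lemma banach_space_on_lp:
  assumes p: "p \<ge> 1"
  shows "banach_space_on seq_scale (lp p :: (nat \<Rightarrow> 'a::{real_normed_field, banach}) set) (lp_norm p)"
proof (rule banach_space_onI)
  fix s x e m
  assume s: "\<And>n. s n \<in> (lp p :: (nat \<Rightarrow> 'a) set)" and l: "\<And>k. (\<lambda>n. s n k) \<longlonglongrightarrow> x k" and e: "e \<ge> 0"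
    and le: "\<And>n. n \<ge> m \<Longrightarrow> lp_norm p (s m - s n) \<le> e"
  have "(\<Sum>k<K. norm ((s m - x) k) powr p) \<le> e powr p" for K
  proof (rule tendsto_upperbound)
    show "(\<lambda>n. \<Sum>k<K. norm ((s m - s n) k) powr p) \<longlonglongrightarrow> (\<Sum>k<K. norm ((s m - x) k) powr p)"
      using p by (intro tendsto_sum tendsto_powr') (auto intro!: tendsto_intros l)
    show "\<forall>\<^sub>F n in sequentially. (\<Sum>k<K. norm ((s m - s n) k) powr p) \<le> e powr p"
    proof (rule eventually_sequentiallyI)
      fix n assume "n \<ge> m"
      have "s m + seq_scale (-1) (s n) \<in> lp p"
        by (intro lp_add lp_scale p s)
      moreover have "s m + seq_scale (-1) (s n) = s m - s n"
        by (simp add: seq_scale_def fun_eq_iff)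
      ultimately have "s m - s n \<in> lp p" by simp
      then show "(\<Sum>k<K. norm ((s m - s n) k) powr p) \<le> e powr p"
        using p le[OF \<open>n \<ge> m\<close>] by (intro lp_norm_sum_le)
    qed
  qed auto
  then show "s m - x \<in> lp p \<and> lp_norm p (s m - x) \<le> e"
    using lp_normI[OF p e, of "s m - x"] by blast
next
  show "0 \<in> (lp p :: (nat \<Rightarrow> 'a) set)" by (simp add: lp_def)
  show "lp_norm p (0 :: nat \<Rightarrow> 'a) = 0" by (simp add: lp_norm_def)
qed (use p in \<open>auto intro: lp_add lp_scale norm_le_lp_norm\<close>)

lemma banach_space_on_c0:
  "banach_space_on seq_scale (c0 :: (nat \<Rightarrow> 'a::{real_normed_field, banach}) set) sup_norm"
proof (rule banach_space_onI)
  show "0 \<in> (c0 :: (nat \<Rightarrow> 'a) set)" by (simp add: c0_def zero_fun_def)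
  show add: "x + y \<in> c0" if "x \<in> c0" "y \<in> c0" for x y :: "nat \<Rightarrow> 'a"
    using that tendsto_add[of x 0 sequentially y 0] by (simp add: c0_def plus_fun_def)
  show smul: "seq_scale c x \<in> c0" if "x \<in> c0" for c and x :: "nat \<Rightarrow> 'a"
    using that tendsto_mult_left[of x 0 sequentially c] by (simp add: c0_def seq_scale_def)
  show "sup_norm (0 :: nat \<Rightarrow> 'a) = 0" by (simp add: sup_norm_def)
  show "norm (x k) \<le> sup_norm x" if "x \<in> c0" for k and x :: "nat \<Rightarrow> 'a"
    by (rule norm_le_sup_norm[OF that])
  show "sup_norm (seq_scale c x) = norm c * sup_norm x" if "x \<in> c0" for c and x :: "nat \<Rightarrow> 'a"
  proof (rule antisym)
    show "sup_norm (seq_scale c x) \<le> norm c * sup_norm x"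
      using that
      by (intro sup_norm_le) (auto simp: seq_scale_def norm_mult intro!: mult_left_mono norm_le_sup_norm)
    show "norm c * sup_norm x \<le> sup_norm (seq_scale c x)"
    proof (cases "c = 0")
      case True
      then show ?thesis by (simp add: seq_scale_def sup_norm_def)
    next
      case False
      have "norm (x k) \<le> sup_norm (seq_scale c x) / norm c" for k
        using norm_le_sup_norm[OF smul[OF that], of c k] False
        by (simp add: seq_scale_def norm_mult field_simps)
      then have "sup_norm x \<le> sup_norm (seq_scale c x) / norm c" by (rule sup_norm_le)
      then show ?thesis using False by (simp add: field_simps)
    qed
  qed
  show "sup_norm (x + y) \<le> sup_norm x + sup_norm y" if "x \<in> c0" "y \<in> c0" for x y :: "nat \<Rightarrow> 'a"
  proof (rule sup_norm_le)
    fix k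
    have "norm ((x + y) k) \<le> norm (x k) + norm (y k)" by (simp add: norm_triangle_ineq)
    also have "\<dots> \<le> sup_norm x + sup_norm y" using that by (intro add_mono norm_le_sup_norm)
    finally show "norm ((x + y) k) \<le> sup_norm x + sup_norm y" .
  qed
  fix s and x :: "nat \<Rightarrow> 'a" and e m
  assume s: "\<And>n. s n \<in> c0"
    and C: "\<And>r. r > 0 \<Longrightarrow> \<exists>m. \<forall>n n'. m \<le> n \<longrightarrow> m \<le> n' \<longrightarrow> sup_norm (s n - s n') < r"
    and l: "\<And>k. (\<lambda>n. s n k) \<longlonglongrightarrow> x k" and e: "e \<ge> 0"
    and le: "\<And>n. n \<ge> m \<Longrightarrow> sup_norm (s m - s n) \<le> e"
  have diff: "y - z \<in> c0" if "y \<in> c0" "z \<in> c0" for y z :: "nat \<Rightarrow> 'a"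
    using that tendsto_diff[of y 0 sequentially z 0] by (simp add: c0_def fun_diff_def)
  have bound: "norm (s m k - x k) \<le> e"
    if le: "\<And>n. n \<ge> m \<Longrightarrow> sup_norm (s m - s n) \<le> e" for m k e
  proof (rule tendsto_upperbound)
    show "(\<lambda>n. norm (s m k - s n k)) \<longlonglongrightarrow> norm (s m k - x k)"
      by (intro tendsto_intros l)
    show "\<forall>\<^sub>F n in sequentially. norm (s m k - s n k) \<le> e"
    proof (rule eventually_sequentiallyI)
      fix n assume "n \<ge> m"
      then show "norm (s m k - s n k) \<le> e"
        using norm_le_sup_norm[OF diff[OF s[of m] s[of n]], of k] le[of n] by simp
    qed
  qed auto
  have "x \<longlonglongrightarrow> 0"
  proof (rule LIMSEQ_I)
    fix r :: real assume "r > 0"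
    then obtain j where j: "\<And>n n'. j \<le> n \<Longrightarrow> j \<le> n' \<Longrightarrow> sup_norm (s n - s n') < r / 2"
      using C[of "r / 2"] by auto
    have "norm (s j k - x k) \<le> r / 2" for k
      using j by (intro bound) (simp add: less_imp_le)
    moreover obtain M where "\<And>k. k \<ge> M \<Longrightarrow> norm (s j k) < r / 2"
      using s[of j] LIMSEQ_D[of "s j" 0 "r / 2"] \<open>r > 0\<close> by (auto simp: c0_def)
    ultimately have "norm (x k - 0) < r" if "k \<ge> M" for k
      using that norm_triangle_ineq4[of "s j k" "s j k - x k"] by (simp, smt (verit) field_sum_of_halves)
    then show "\<exists>M. \<forall>k\<ge>M. norm (x k - 0) < r" by blast
  qed
  then have "x \<in> c0" by (simp add: c0_def)
  then show "s m - x \<in> c0 \<and> sup_norm (s m - x) \<le> e"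
    using diff[OF s] bound[OF le] by (auto intro!: sup_norm_le)
qed

lemma banach_space_on_lp_or_c0:
  fixes X :: "(nat \<Rightarrow> 'a::{real_normed_field, banach}) set"
  assumes "lp_or_c0 X N"
  shows "banach_space_on seq_scale X N"
  using assms banach_space_on_lp banach_space_on_c0 by (auto simp: lp_or_c0_def)

end

theory Submission
  imports Defs "HOL-Library.Discrete_Functions"
begin

text \<open>
  Put \<open>W k = w\<^sup>1 w\<^sup>2 \<cdots> w\<^sup>k\<close> and write a sequence as \<open>x k = u k / W k\<close>. In terms of \<open>u\<close> the weighted
  shift is the plain backward shift \<open>u k \<mapsto> u (k + 1)\<close> (\<open>wshift_weighted\<close>). Since \<open>\<bar>W k\<bar>\<close> grows faster
  than every geometric sequence, each \<open>u\<close> of at most exponential growth yields an absolutely summable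
  \<open>x\<close>, and so do all its shifts. Such \<open>x\<close> therefore lie in the domains of all powers of the operator
  (\<open>weighted_C_infinity\<close>). Moreover, if \<open>u\<close> obeys a fixed exponential bound and vanishes below a large
  index \<open>n\<close>, then the norm of \<open>x\<close> is small, uniformly in \<open>u\<close> (\<open>tail_small\<close>).

  Everything is now visible on the side of \<open>u\<close>. A geometric sequence \<open>u k = l\<^sup>k\<close> gives an eigenvector
  for \<open>l\<close>, and the recursion \<open>w\<^bsup>k+1\<^esup> x (k + 1) = l x k\<close> shows that it is the only one up to scalars;
  as no \<open>l\<close> gives an injective operator \<open>A - l\<close>, the spectrum is everything. A periodic \<open>u\<close> gives a
  periodic point; repeating a finite word with a long period changes it only in a far tail, so that
  the periodic points are dense (\<open>periodic_points_dense\<close>). A hypercyclic vector arises from a single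
  \<open>u\<close> that contains every finite word over a countable dense set of scalars, each infinitely often
  and followed by ever longer stretches of zeros: shifting \<open>u\<close> to such an occurrence leaves the word
  and a small tail (\<open>block_sequence_orbit_approx\<close>). Unboundedness is seen on the unit vectors.

  The spaces \<open>l\<^sub>p\<close> and \<open>c\<^sub>0\<close> enter through three features: coordinates are bounded by the norm,
  the norm is bounded by the \<open>l\<^sub>1\<close> norm, and truncations of a vector converge to it.
\<close>

section \<open>Sequence spaces between absolutely summable and bounded sequences\<close>

text \<open>
  The first two norm bounds say that \<open>X\<close> lies between \<open>l\<^sub>1\<close> and the bounded sequences, with inclusions of
  norm at most one; the last assumption makes the finitely supported sequences dense. The upper
  bound is phrased with an arbitrary majorant \<open>b\<close> because that is how it is applied.
\<close>

locale solid_sequence_space = normed_space_on seq_scale X N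
  for X :: "(nat \<Rightarrow> 'a::real_normed_field) set" and N +
  assumes norm_coord_le: "x \<in> X \<Longrightarrow> norm (x k) \<le> N x"
    and majorant_mem: "summable b \<Longrightarrow> (\<And>k. norm (x k) \<le> b k) \<Longrightarrow> x \<in> X"
    and majorant_norm: "summable b \<Longrightarrow> (\<And>k. norm (x k) \<le> b k) \<Longrightarrow> N x \<le> suminf b"
    and truncation_approx: "x \<in> X \<Longrightarrow> e > 0 \<Longrightarrow> \<exists>m. N (x - (\<lambda>k. if k < m then x k else 0)) < e"

lemma (in solid_sequence_space) finite_support:
  assumes "\<And>k. k \<ge> m \<Longrightarrow> x k = 0"
  shows "x \<in> X" "N x \<le> (\<Sum>k<m. norm (x k))"
proof -
  have b: "summable (\<lambda>k. norm (x k))"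
    by (rule summable_finite[of "{..<m}"]) (auto simp: assms)
  have "(\<Sum>k. norm (x k)) = (\<Sum>k<m. norm (x k))"
    by (rule suminf_finite) (auto simp: assms)
  then show "x \<in> X" "N x \<le> (\<Sum>k<m. norm (x k))"
    using majorant_mem[OF b, of x] majorant_norm[OF b, of x] by simp_all
qed

text \<open>
  With \<open>S\<close> the sum of the majorant, each term satisfies \<open>\<bar>x k\<bar>\<^sup>p \<le> b k \<cdot> S\<^bsup>p-1\<^esup>\<close>, since both \<open>\<bar>x k\<bar>\<close> and
  \<open>b k\<close> are at most \<open>S\<close>; summing gives \<open>S\<^sup>p\<close>.
\<close>

lemma lp_majorant:
  fixes x :: "nat \<Rightarrow> 'a::real_normed_vector"
  assumes p: "p \<ge> 1" and b: "summable b" and le: "\<And>k. norm (x k) \<le> b k"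
  shows "x \<in> lp p" "lp_norm p x \<le> suminf b"
proof -
  have b0: "0 \<le> b k" for k using le[of k] norm_ge_zero order_trans by blast
  have S0: "0 \<le> suminf b" by (simp add: b b0 suminf_nonneg)
  have "(\<Sum>k<K. norm (x k) powr p) \<le> suminf b powr p" for K
  proof -
    have bS: "b k \<le> suminf b" for k
      using sum_le_suminf[OF b, of "{k}"] b0 by simp
    have "norm (x k) powr p \<le> b k * suminf b powr (p - 1)" for k
    proof -
      have "norm (x k) powr p = norm (x k) * norm (x k) powr (p - 1)"
        by (simp add: powr_mult_base)
      also have "\<dots> \<le> b k * suminf b powr (p - 1)"
        using p le[of k] bS[of k] b0[of k] by (intro mult_mono powr_mono2) auto
      finally show ?thesis .
    qed
    then have "(\<Sum>k<K. norm (x k) powr p) \<le> (\<Sum>k<K. b k) * suminf b powr (p - 1)"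
      unfolding sum_distrib_right by (intro sum_mono)
    also have "\<dots> \<le> suminf b * suminf b powr (p - 1)"
      using sum_le_suminf[OF b, of "{..<K}"] b0 by (intro mult_right_mono) auto
    also have "\<dots> = suminf b powr p" using S0 by (simp add: powr_mult_base)
    finally show ?thesis .
  qed
  then show "x \<in> lp p" "lp_norm p x \<le> suminf b"
    using lp_normI[OF p S0, of x] by auto
qed

lemma lp_truncation_approx:
  fixes x :: "nat \<Rightarrow> 'a::real_normed_vector"
  assumes p: "p \<ge> 1" and x: "x \<in> lp p" and e: "e > 0"
  shows "\<exists>m. lp_norm p (x - (\<lambda>k. if k < m then x k else 0)) < e"
proof -
  define f where "f = (\<lambda>k. norm (x k) powr p)"
  have f: "summable f" using x by (simp add: lp_def f_def)
  have "(e / 2) powr p > 0" using e by simp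
  then obtain m where m: "norm (sum f {m..<n}) < (e / 2) powr p" for n
    using f unfolding summable_Cauchy by (meson order_refl)
  define y where "y = x - (\<lambda>k. if k < m then x k else 0)"
  have "(\<Sum>k<K. norm (y k) powr p) \<le> (e / 2) powr p" for K
  proof -
    have "(\<Sum>k<K. norm (y k) powr p) = (\<Sum>k\<in>{m..<K}. f k)"
      by (rule sum.mono_neutral_cong_right) (auto simp: y_def f_def)
    then show ?thesis using m[of K] by simp
  qed
  then have "lp_norm p y \<le> e / 2" using lp_normI[OF p, of "e / 2" y] e by auto
  then show ?thesis using e unfolding y_def by (intro exI[of _ m]) simp
qed

lemma solid_lp:
  assumes "p \<ge> 1"
  shows "solid_sequence_space (lp p :: (nat \<Rightarrow> 'a::{real_normed_field, banach}) set) (lp_norm p)"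
proof -
  interpret banach_space_on seq_scale "lp p :: (nat \<Rightarrow> 'a) set" "lp_norm p"
    by (rule banach_space_on_lp[OF assms])
  show ?thesis
    by unfold_locales
      (use assms in \<open>auto intro: norm_le_lp_norm lp_majorant lp_truncation_approx\<close>)
qed

lemma solid_c0:
  "solid_sequence_space (c0 :: (nat \<Rightarrow> 'a::{real_normed_field, banach}) set) sup_norm"
proof -
  interpret banach_space_on seq_scale "c0 :: (nat \<Rightarrow> 'a) set" sup_norm
    by (rule banach_space_on_c0)
  show ?thesis
  proof
    fix x :: "nat \<Rightarrow> 'a" and b
    assume b: "summable b" and le: "\<And>k. norm (x k) \<le> b k"
    show "x \<in> c0" unfolding c0_def mem_Collect_eq
      by (rule Lim_null_comparison[OF _ summable_LIMSEQ_zero[OF b]]) (simp add: le)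
    show "sup_norm x \<le> suminf b"
    proof (rule sup_norm_le)
      fix k
      have "b i \<ge> 0" for i using le[of i] norm_ge_zero order_trans by blast
      then show "norm (x k) \<le> suminf b"
        using sum_le_suminf[OF b, of "{k}"] le[of k] by force
    qed
  next
    fix x :: "nat \<Rightarrow> 'a" and e :: real
    assume "x \<in> c0" "e > 0"
    then obtain m where m: "\<And>k. k \<ge> m \<Longrightarrow> norm (x k) < e / 2"
      using LIMSEQ_D[of x 0 "e / 2"] by (auto simp: c0_def)
    have "sup_norm (x - (\<lambda>k. if k < m then x k else 0)) \<le> e / 2"
      using m \<open>e > 0\<close> by (intro sup_norm_le) (force simp: less_imp_le not_less)
    then show "\<exists>m. sup_norm (x - (\<lambda>k. if k < m then x k else 0)) < e"
      using \<open>e > 0\<close> by (intro exI[of _ m]) simp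
  qed (rule norm_le_sup_norm)
qed

lemma solid_lp_or_c0:
  fixes X :: "(nat \<Rightarrow> 'a::{real_normed_field, banach}) set"
  assumes "lp_or_c0 X N"
  shows "solid_sequence_space X N"
  using assms solid_lp solid_c0 by (auto simp: lp_or_c0_def)

lemma (in normed_space_on) dense_inI:
  assumes S: "S \<subseteq> X" and near: "\<And>x e. x \<in> X \<Longrightarrow> e > 0 \<Longrightarrow> \<exists>s\<in>S. N (x - s) < e"
  shows "dense_in X N S"
proof -
  interpret M: Metric_space X "norm_dist X N" by (rule Metric_space_norm_dist)
  have "\<exists>s\<in>S. s \<in> M.mball x r" if "x \<in> X" "r > 0" for x r
    using near[OF that] S that by (auto simp: M.mball_def norm_dist_def)
  then show ?thesis using S by (auto simp: dense_in_def M.metric_closure_of)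
qed

section \<open>Straightening the weights\<close>

definition weight :: "'a::comm_monoid_mult \<Rightarrow> nat \<Rightarrow> 'a" where
  "weight w k = (\<Prod>i<k. w ^ Suc i)"

definition weighted :: "'a::field \<Rightarrow> (nat \<Rightarrow> 'a) \<Rightarrow> nat \<Rightarrow> 'a" where
  "weighted w u = (\<lambda>k. u k / weight w k)"

lemma weight_Suc: "weight w (Suc k) = w ^ Suc k * weight w k"
  by (simp add: weight_def mult.commute)

lemma weight_nonzero: "w \<noteq> 0 \<Longrightarrow> weight w k \<noteq> (0 :: 'a::field)"
  by (simp add: weight_def)

lemma weighted_inverse:
  fixes w :: "'a::field"
  shows "w \<noteq> 0 \<Longrightarrow> weighted w (\<lambda>k. weight w k * x k) = x"
  by (simp add: weighted_def weight_nonzero)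

text \<open>
  This conjugacy with the unweighted shift reduces every orbit computation to a translation of
  indices.
\<close>

lemma wshift_weighted:
  fixes w :: "'a::field"
  assumes "w \<noteq> 0"
  shows "wshift w (weighted w u) = weighted w (\<lambda>k. u (Suc k))"
  using assms by (simp add: wshift_def weighted_def weight_Suc fun_eq_iff del: power_Suc)

lemma wshift_funpow_weighted:
  fixes w :: "'a::field"
  assumes "w \<noteq> 0"
  shows "(wshift w ^^ n) (weighted w u) = weighted w (\<lambda>k. u (k + n))"
  by (induction n) (simp_all add: wshift_weighted assms)

text \<open>The quotient of consecutive terms is \<open>r / w\<^bsup>k+1\<^esup>\<close> in absolute value, which tends to \<open>0\<close>.\<close>

lemma summable_power_over_weight:
  fixes w :: "'a::real_normed_field" and r :: real
  assumes w: "norm w > 1"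
  shows "summable (\<lambda>k. r ^ k / norm (weight w k))"
proof -
  have "(\<lambda>k. \<bar>r\<bar> * inverse (norm w ^ Suc k)) \<longlonglongrightarrow> \<bar>r\<bar> * 0"
    by (intro tendsto_intros LIMSEQ_Suc[OF LIMSEQ_inverse_realpow_zero] w)
  then have "\<forall>\<^sub>F k in sequentially. \<bar>r\<bar> * inverse (norm w ^ Suc k) < 1 / 2"
    by (rule order_tendstoD) simp
  then obtain K where K: "\<And>k. k \<ge> K \<Longrightarrow> \<bar>r\<bar> * inverse (norm w ^ Suc k) < 1 / 2"
    by (auto simp: eventually_sequentially)
  show ?thesis
  proof (rule summable_ratio_test[of "1 / 2" K])
    fix k assume "k \<ge> K"
    have "norm (r ^ Suc k / norm (weight w (Suc k))) =
        (\<bar>r\<bar> * inverse (norm w ^ Suc k)) * norm (r ^ k / norm (weight w k))"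
      by (simp add: weight_Suc norm_mult norm_power abs_mult power_abs field_simps)
    also have "\<dots> \<le> 1 / 2 * norm (r ^ k / norm (weight w k))"
      using K[OF \<open>k \<ge> K\<close>] by (intro mult_right_mono) auto
    finally show "norm (r ^ Suc k / norm (weight w (Suc k))) \<le> 1 / 2 * norm (r ^ k / norm (weight w k))" .
  qed simp
qed

locale wshift_on_solid = solid_sequence_space X N
  for X :: "(nat \<Rightarrow> 'a::real_normed_field) set" and N +
  fixes w :: 'a
  assumes norm_w: "norm w > 1"
begin

lemma w_nonzero: "w \<noteq> 0"
  using norm_w by auto

lemma weighted_mem:
  assumes "\<And>k. norm (u k) \<le> M * r ^ k"
  shows "weighted w u \<in> X"
proof (rule majorant_mem)
  show "summable (\<lambda>k. M * (r ^ k / norm (weight w k)))"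
    by (intro summable_mult summable_power_over_weight norm_w)
  show "norm (weighted w u k) \<le> M * (r ^ k / norm (weight w k))" for k
    using divide_right_mono[OF assms, of "norm (weight w k)"]
    by (simp add: weighted_def norm_divide)
qed

lemma C_infinityI:
  assumes "\<And>n. (wshift w ^^ n) x \<in> X"
  shows "x \<in> C_infinity X (wshift_domain w X) (wshift w)"
proof -
  have "x \<in> power_domain X (wshift_domain w X) (wshift w) n" for n
  proof (induction n)
    case 0
    then show ?case using assms[of 0] by simp
  next
    case (Suc n)
    then show ?case using assms[of n] assms[of "Suc n"] by (simp add: wshift_domain_def)
  qed
  then show ?thesis by (simp add: C_infinity_def)
qed

text \<open>Exponential bounds are stable under translation: \<open>M\<close> merely becomes \<open>M r\<^sup>n\<close>.\<close>

lemma funpow_weighted_mem: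
  assumes u: "\<And>k. norm (u k) \<le> M * r ^ k"
  shows "(wshift w ^^ n) (weighted w u) \<in> X"
proof -
  have "norm (u (k + n)) \<le> (M * r ^ n) * r ^ k" for k
    using u[of "k + n"] by (simp add: power_add mult_ac)
  then show ?thesis
    unfolding wshift_funpow_weighted[OF w_nonzero] by (rule weighted_mem)
qed

lemma weighted_C_infinity:
  assumes "\<And>k. norm (u k) \<le> M * r ^ k"
  shows "weighted w u \<in> C_infinity X (wshift_domain w X) (wshift w)"
  using assms by (intro C_infinityI funpow_weighted_mem)

text \<open>
  The threshold depends on the growth bound alone, not on \<open>u\<close>. This uniformity is what allows the
  sequences below to be chosen after the threshold.
\<close>

lemma tail_small:
  assumes e: "e > 0"
  obtains n\<^sub>0 where "\<And>n u. n \<ge> n\<^sub>0 \<Longrightarrow> (\<And>k. k < n \<Longrightarrow> u k = 0) \<Longrightarrow>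
      (\<And>k. norm (u k) \<le> M * r ^ k) \<Longrightarrow> N (weighted w u) < e"
proof -
  define f where "f = (\<lambda>k. M * (r ^ k / norm (weight w k)))"
  have f: "summable f"
    unfolding f_def by (intro summable_mult summable_power_over_weight norm_w)
  obtain n\<^sub>0 where n0: "\<And>n. n \<ge> n\<^sub>0 \<Longrightarrow> norm (\<Sum>k. f (k + n)) < e"
    using suminf_exist_split[OF e f] by blast
  show ?thesis
  proof
    fix n and u :: "nat \<Rightarrow> 'a"
    assume n: "n \<ge> n\<^sub>0" and z: "\<And>k. k < n \<Longrightarrow> u k = 0" and le: "\<And>k. norm (u k) \<le> M * r ^ k"
    define g where "g = (\<lambda>k. if k < n then 0 else f k)"
    have g: "summable g"
      by (rule iffD1[OF summable_cong f]) (auto simp: g_def eventually_sequentially intro: exI[of _ n])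
    have "norm (weighted w u k) \<le> g k" for k
      using divide_right_mono[OF le[of k], of "norm (weight w k)"] z[of k]
      by (simp add: weighted_def norm_divide g_def f_def)
    then have "N (weighted w u) \<le> suminf g" by (rule majorant_norm[OF g])
    also have "suminf g = (\<Sum>k. g (k + n)) + (\<Sum>k<n. g k)"
      by (rule suminf_split_initial_segment[OF g])
    also have "\<dots> = (\<Sum>k. f (k + n))" by (simp add: g_def)
    also have "\<dots> < e" using n0[OF n] by simp
    finally show "N (weighted w u) < e" .
  qed
qed

lemma weighted_diff: "weighted w u - weighted w v = weighted w (\<lambda>k. u k - v k)"
  by (simp add: weighted_def fun_eq_iff diff_divide_distrib)

text \<open>
  A truncation of \<open>x\<close> is near \<open>x\<close>, and it is the weighted form of a finitely supported \<open>u\<close>; hence only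
  such targets have to be approximated.
\<close>

lemma dense_in_if_approx_finite:
  assumes S: "S \<subseteq> X"
    and near: "\<And>u m e. (\<And>k. k \<ge> m \<Longrightarrow> u k = 0) \<Longrightarrow> e > 0 \<Longrightarrow> \<exists>s\<in>S. N (weighted w u - s) < e"
  shows "dense_in X N S"
proof (rule dense_inI[OF S])
  fix x :: "nat \<Rightarrow> 'a" and e :: real
  assume x: "x \<in> X" and e: "e > 0"
  obtain m where m: "N (x - (\<lambda>k. if k < m then x k else 0)) < e / 2"
    using truncation_approx[OF x, of "e / 2"] e by auto
  define y where "y = (\<lambda>k. if k < m then x k else 0)"
  have y: "y \<in> X"
    by (rule finite_support(1)[of m]) (simp add: y_def)
  have yw: "weighted w (\<lambda>k. weight w k * y k) = y"
    by (rule weighted_inverse[OF w_nonzero])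
  obtain s where s: "s \<in> S" "N (y - s) < e / 2"
    using near[of m "\<lambda>k. weight w k * y k" "e / 2"] e unfolding yw by (auto simp: y_def)
  have "N ((x - y) + (y - s)) \<le> N (x - y) + N (y - s)"
    using x y s S by (intro norm_triangle subspace_diff[OF subspace_carrier]) auto
  then show "\<exists>s\<in>S. N (x - s) < e"
    using m s by (intro bexI[of _ s]) (auto simp: y_def[symmetric])
qed

section \<open>The weighted shift is an unbounded linear operator\<close>

lemma linear_operator: "linear_operator_in seq_scale X (wshift_domain w X) (wshift w)"
proof -
  have add: "wshift w (x + y) = wshift w x + wshift w y" for x y
    by (simp add: wshift_def fun_eq_iff algebra_simps)
  have scale: "wshift w (seq_scale c x) = seq_scale c (wshift w x)" for c x
    by (simp add: wshift_def seq_scale_def fun_eq_iff mult_ac)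
  have zero: "wshift w 0 = 0" by (simp add: wshift_def fun_eq_iff)
  have "subspace (wshift_domain w X)"
    using subspace_carrier by (auto simp: subspace_def wshift_domain_def add scale zero)
  then show ?thesis
    by (auto simp: linear_operator_in_def wshift_domain_def add scale)
qed

text \<open>
  All unit vectors have norm one, while the shift maps the unit vector number \<open>n + 1\<close> to \<open>w\<^bsup>n+1\<^esup>\<close> times
  the unit vector number \<open>n\<close>.
\<close>

lemma unbounded: "\<not> bounded_on N (wshift_domain w X) (wshift w)"
proof
  assume "bounded_on N (wshift_domain w X) (wshift w)"
  then obtain C where C: "\<And>x. x \<in> wshift_domain w X \<Longrightarrow> N (wshift w x) \<le> C * N x"
    by (auto simp: bounded_on_def)
  define unit :: "nat \<Rightarrow> nat \<Rightarrow> 'a" where "unit = (\<lambda>n k. if k = n then 1 else 0)"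
  have unit: "unit n \<in> X" "N (unit n) = 1" for n
  proof -
    have z: "unit n k = 0" if "k \<ge> Suc n" for k
      using that by (simp add: unit_def)
    show X: "unit n \<in> X" by (rule finite_support(1)[OF z])
    have "(\<Sum>k<Suc n. norm (unit n k)) = 1" by (simp add: unit_def)
    then show "N (unit n) = 1"
      using finite_support(2)[of "Suc n" "unit n", OF z] norm_coord_le[OF X, of n]
      by (simp add: unit_def)
  qed
  have shift: "wshift w (unit (Suc n)) = seq_scale (w ^ Suc n) (unit n)" for n
    by (auto simp: wshift_def unit_def seq_scale_def fun_eq_iff)
  have "norm w ^ Suc n \<le> C" for n
  proof -
    have "unit (Suc n) \<in> wshift_domain w X"
      using unit subspace_scale[OF subspace_carrier] by (simp add: wshift_domain_def shift)
    from C[OF this] show ?thesis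
      using unit by (simp add: shift norm_scale norm_power norm_mult)
  qed
  moreover obtain n where "C < norm w ^ n"
    using real_arch_pow[OF norm_w] by blast
  moreover have "norm w ^ n \<le> norm w ^ Suc n"
    using norm_w by (intro power_increasing) auto
  ultimately show False by (metis linorder_not_less order_trans)
qed

section \<open>Periodic points\<close>

text \<open>
  To approximate the vector of a finite word \<open>u\<close>, repeat \<open>u\<close> with a period \<open>n\<close> beyond its length. The two
  sequences agree below \<open>n\<close> and their difference is bounded independently of \<open>n\<close>, so it is
  negligible for large \<open>n\<close>.
\<close>

lemma periodic_points_dense:
  "dense_in X N (periodic_points X (wshift_domain w X) (wshift w))"
proof (rule dense_in_if_approx_finite)
  show "periodic_points X (wshift_domain w X) (wshift w) \<subseteq> X"
    by (auto simp: periodic_points_def C_infinity_def dest!: spec[of _ 0])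
next
  fix u :: "nat \<Rightarrow> 'a" and m and e :: real
  assume u0: "\<And>k. k \<ge> m \<Longrightarrow> u k = 0" and e: "e > 0"
  define M where "M = (\<Sum>k<m. norm (u k))"
  have M: "norm (u k) \<le> M" for k
  proof (cases "k < m")
    case True
    then show ?thesis unfolding M_def by (intro member_le_sum) auto
  qed (simp add: u0 M_def sum_nonneg)
  obtain n\<^sub>0 where n0: "\<And>n v. n \<ge> n\<^sub>0 \<Longrightarrow> (\<And>k. k < n \<Longrightarrow> v k = 0) \<Longrightarrow>
      (\<And>k. norm (v k) \<le> (M + M) * 1 ^ k) \<Longrightarrow> N (weighted w v) < e"
    using tail_small[of e "M + M" 1] e by auto
  \<comment> \<open>The successor only ensures that the period is positive.\<close>
  define n where "n = Suc (max m n\<^sub>0)"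
  define v where "v = (\<lambda>k. u (k mod n))"
  have "(wshift w ^^ n) (weighted w v) = weighted w v"
    by (simp add: wshift_funpow_weighted[OF w_nonzero] v_def)
  moreover have "weighted w v \<in> C_infinity X (wshift_domain w X) (wshift w)"
    by (rule weighted_C_infinity[of _ M 1]) (simp_all add: v_def M)
  ultimately have "weighted w v \<in> periodic_points X (wshift_domain w X) (wshift w)"
    unfolding periodic_points_def by (auto intro!: exI[of _ n] simp: n_def)
  moreover have "N (weighted w u - weighted w v) < e"
    unfolding weighted_diff
  proof (rule n0[of n])
    show "norm (u k - v k) \<le> (M + M) * 1 ^ k" for k
      using norm_triangle_ineq4[of "u k" "v k"] M[of k] M[of "k mod n"] by (simp add: v_def)
  qed (simp_all add: n_def v_def)
  ultimately show "\<exists>s\<in>periodic_points X (wshift_domain w X) (wshift w). N (weighted w u - s) < e"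
    by blast
qed

section \<open>Eigenvectors\<close>

text \<open>
  The eigenvalue equation is a recursion that determines \<open>x\<close> from \<open>x 0\<close>. It covers \<open>l = 0\<close>, where
  \<open>l\<^sup>0 = 1\<close> leaves the first unit vector.
\<close>

lemma wshift_eigenvector_iff:
  "wshift w x = seq_scale l x \<longleftrightarrow> x = seq_scale (x 0) (weighted w (\<lambda>k. l ^ k))"
proof
  assume eq: "wshift w x = seq_scale l x"
  have "x k = x 0 * (l ^ k / weight w k)" for k
  proof (induction k)
    case 0
    then show ?case by (simp add: weight_def)
  next
    case (Suc k)
    have "w ^ Suc k * x (Suc k) = l * x k"
      using fun_cong[OF eq, of k] by (simp add: wshift_def seq_scale_def)
    then have "x (Suc k) = l * x k / w ^ Suc k"
      using w_nonzero by (simp add: field_simps)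
    then show ?case using Suc by (simp add: weight_Suc mult_ac)
  qed
  then show "x = seq_scale (x 0) (weighted w (\<lambda>k. l ^ k))"
    unfolding seq_scale_def weighted_def by (intro ext)
next
  assume x: "x = seq_scale (x 0) (weighted w (\<lambda>k. l ^ k))"
  have "wshift w (seq_scale c (weighted w (\<lambda>k. l ^ k))) = seq_scale l (seq_scale c (weighted w (\<lambda>k. l ^ k)))" for c
    using w_nonzero by (simp add: wshift_def seq_scale_def weighted_def weight_Suc fun_eq_iff)
  from this[of "x 0"] show "wshift w x = seq_scale l x"
    unfolding x[symmetric] .
qed

lemma eigenspace_eq_span:
  "eigenspace seq_scale (wshift_domain w X) (wshift w) l = span {weighted w (\<lambda>k. l ^ k)}"
proof -
  let ?v = "weighted w (\<lambda>k. l ^ k)"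
  have v: "?v \<in> X"
    by (rule weighted_mem[of _ 1 "norm l"]) (simp add: norm_power)
  have "x \<in> wshift_domain w X \<and> wshift w x = seq_scale l x \<longleftrightarrow> (\<exists>c. x = seq_scale c ?v)" for x
  proof
    assume "\<exists>c. x = seq_scale c ?v"
    then obtain c where c: "x = seq_scale c ?v" ..
    then have "x 0 = c" by (simp add: seq_scale_def weighted_def weight_def)
    then have eq: "wshift w x = seq_scale l x" using c wshift_eigenvector_iff by blast
    moreover have "x \<in> X" unfolding c by (intro subspace_scale subspace_carrier v)
    ultimately show "x \<in> wshift_domain w X \<and> wshift w x = seq_scale l x"
      by (simp add: wshift_domain_def subspace_scale[OF subspace_carrier])
  qed (use wshift_eigenvector_iff in blast)
  then show ?thesis by (auto simp: eigenspace_def span_singleton)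
qed

lemma eigenvector_nonzero: "weighted w (\<lambda>k. l ^ k) \<noteq> 0"
proof
  assume "weighted w (\<lambda>k. l ^ k) = 0"
  from fun_cong[OF this, of 0] show False by (simp add: weighted_def weight_def)
qed

lemma eigenvalue: "eigenvalue seq_scale (wshift_domain w X) (wshift w) l"
  unfolding eigenvalue_def eigenspace_eq_span
  by (intro bexI[of _ "weighted w (\<lambda>k. l ^ k)"] eigenvector_nonzero span_base) simp

lemma dim_eigenspace: "dim (eigenspace seq_scale (wshift_domain w X) (wshift w) l) = 1"
  unfolding eigenspace_eq_span
  by (subst dim_span_eq_card_independent) (auto simp: eigenvector_nonzero)

lemma spectrum_eq_UNIV: "spectrum seq_scale X N (wshift_domain w X) (wshift w) = UNIV"
proof -
  have "\<not> inj_on (\<lambda>x. wshift w x - seq_scale l x) (wshift_domain w X)" for l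
  proof -
    obtain v where v: "v \<in> wshift_domain w X" "wshift w v = seq_scale l v" "v \<noteq> 0"
      using eigenvalue[of l] by (auto simp: eigenvalue_def eigenspace_def)
    have "wshift w 0 = 0" by (simp add: wshift_def fun_eq_iff)
    then have "0 \<in> wshift_domain w X" "wshift w 0 = seq_scale l 0"
      using subspace_0[OF subspace_carrier] by (simp_all add: wshift_domain_def)
    with v show ?thesis
      using inj_onD[of "\<lambda>x. wshift w x - seq_scale l x" "wshift_domain w X" v 0]
      by (metis diff_self)
  qed
  then show ?thesis by (auto simp: spectrum_def resolvent_set_def bij_betw_def)
qed

end

section \<open>A hypercyclic vector\<close>

definition word :: "'a::zero list \<Rightarrow> nat \<Rightarrow> 'a" where
  "word xs k = (if k < length xs then xs ! k else 0)"

text \<open>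
  Block \<open>j\<close> occupies the indices from \<open>2\<^sup>j\<close> to \<open>2\<^bsup>j+1\<^esup> - 1\<close> and contains the word with number
  \<open>fst (prod_decode j)\<close>, so every word occurs in infinitely many blocks, hence in arbitrarily long
  ones. Entries that are too large for their position are replaced by zero, which keeps the growth
  of the sequence linear; a given word is unaffected in all late blocks.
\<close>

definition block_sequence :: "(nat \<Rightarrow> 'a::real_normed_field list) \<Rightarrow> nat \<Rightarrow> 'a" where
  "block_sequence c k =
     (let j = floor_log k; a = word (c (fst (prod_decode j))) (k - 2 ^ j)
      in if norm a \<le> real k then a else 0)"

lemma norm_block_sequence_le: "norm (block_sequence c k) \<le> 2 ^ k"
proof -
  have "norm (block_sequence c k) \<le> real k" by (simp add: block_sequence_def Let_def)
  also have "\<dots> \<le> 2 ^ k" by (metis less_imp_le of_nat_less_two_power)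
  finally show ?thesis .
qed

lemma block_sequence_at:
  assumes "k < 2 ^ prod_encode (i, t)" "norm (word (c i) k) \<le> 2 ^ prod_encode (i, t)"
  shows "block_sequence c (k + 2 ^ prod_encode (i, t)) = word (c i) k"
proof -
  let ?j = "prod_encode (i, t)"
  have "floor_log (k + 2 ^ ?j) = ?j"
    using assms(1) by (intro floor_log_eqI) auto
  then show ?thesis using assms(2) by (simp add: block_sequence_def)
qed

lemma word_approx:
  fixes u :: "nat \<Rightarrow> 'a::real_normed_vector"
  assumes dense: "\<And>U. open U \<Longrightarrow> U \<noteq> {} \<Longrightarrow> \<exists>d\<in>D. d \<in> U"
    and u: "\<And>k. k \<ge> m \<Longrightarrow> u k = 0" and e: "e > 0"
  obtains xs where "xs \<in> lists D" "length xs = m" "\<And>k. norm (u k - word xs k) < e"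
proof -
  have "\<exists>d\<in>D. dist (u k) d < e" for k
    using dense[of "ball (u k) e"] e by auto
  then obtain d where d: "\<And>k. d k \<in> D" "\<And>k. dist (u k) (d k) < e" by metis
  show ?thesis
  proof
    show "map d [0..<m] \<in> lists D" using d by auto
    show "length (map d [0..<m]) = m" by simp
    show "norm (u k - word (map d [0..<m]) k) < e" for k
      using d(2)[of k] u[of k] e by (auto simp: word_def dist_norm)
  qed
qed

text \<open>
  Shifting by the start \<open>n = 2\<^sup>j\<close> of a late block containing the word leaves exactly the word below index
  \<open>n\<close>, because the block is as long as its starting index. From \<open>n\<close> on, the bound \<open>2\<^bsup>k+n\<^esup>\<close> of the shifted
  sequence is at most \<open>4\<^sup>k\<close>: although the shift distance grows, the growth bound stays fixed, and the
  tail is small.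
\<close>

lemma (in wshift_on_solid) block_sequence_orbit_approx:
  assumes e: "e > 0"
  obtains n where "N (weighted w (word (c i)) - (wshift w ^^ n) (weighted w (block_sequence c))) < e"
proof -
  obtain n\<^sub>0 where n0: "\<And>n v. n \<ge> n\<^sub>0 \<Longrightarrow> (\<And>k. k < n \<Longrightarrow> v k = 0) \<Longrightarrow>
      (\<And>k. norm (v k) \<le> 1 * 4 ^ k) \<Longrightarrow> N (weighted w v) < e"
    using tail_small[of e 1 4] e by auto
  define M where "M = (\<Sum>a\<leftarrow>c i. norm a)"
  have M: "norm (word (c i) k) \<le> M" for k
  proof (cases "k < length (c i)")
    case True
    then show ?thesis
      unfolding M_def by (auto simp: word_def intro!: member_le_sum_list)
  qed (auto simp: word_def M_def intro!: sum_list_nonneg)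
  \<comment> \<open>A repetition so late that its block contains the word and lets all its entries pass.\<close>
  obtain t where t: "n\<^sub>0 \<le> t" "length (c i) \<le> t" "M \<le> real t"
    using real_arch_simple[of "max (real n\<^sub>0) (max (real (length (c i))) M)"] by auto
  define n :: nat where "n = 2 ^ prod_encode (i, t)"
  have "t \<le> prod_encode (i, t)" by (rule le_prod_encode_2)
  also have "\<dots> < n" unfolding n_def by (rule less_exp)
  finally have tn: "t < n" .
  define v where "v = (\<lambda>k. word (c i) k - block_sequence c (k + n))"
  have "N (weighted w v) < e"
  proof (rule n0[of n])
    show "n\<^sub>0 \<le> n" using t tn by simp
    show v0: "v k = 0" if "k < n" for k
    proof -
      have "norm (word (c i) k) \<le> 2 ^ prod_encode (i, t)"
      proof -
        have "norm (word (c i) k) \<le> real t" using M[of k] t(3) by linarith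
        also have "\<dots> \<le> real n" using tn by simp
        also have "real n = 2 ^ prod_encode (i, t)" by (simp add: n_def)
        finally show ?thesis .
      qed
      then show ?thesis
        using block_sequence_at[of k i t c] that by (simp add: v_def n_def)
    qed
    show "norm (v k) \<le> 1 * 4 ^ k" for k
    proof (cases "k < n")
      case False
      then have "v k = - block_sequence c (k + n)"
        using t tn by (simp add: v_def word_def)
      then have "norm (v k) \<le> 2 ^ (k + n)"
        using norm_block_sequence_le[of c "k + n"] by simp
      also have "\<dots> \<le> (2::real) ^ (2 * k)"
        using False by (intro power_increasing) auto
      finally show ?thesis by (simp add: power_mult)
    qed (simp add: v0)
  qed
  then show ?thesis
    by (intro that[of n]) (simp add: wshift_funpow_weighted[OF w_nonzero] weighted_diff v_def)
qed

text \<open>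
  A finitely supported target is approximated by a word over the dense set \<open>D\<close>, entry by entry, and
  the word is in turn approximated by a point of the orbit.
\<close>

theorem hypercyclic_wshift:
  fixes X :: "(nat \<Rightarrow> 'a::{real_normed_field, second_countable_topology}) set"
  assumes "wshift_on_solid X N w"
  shows "hypercyclic X N (wshift_domain w X) (wshift w)"
proof -
  interpret wshift_on_solid X N w by fact
  obtain D :: "'a set" where D: "countable D" "\<And>U. open U \<Longrightarrow> U \<noteq> {} \<Longrightarrow> \<exists>d\<in>D. d \<in> U"
    by (rule countable_dense_setE) blast
  define c where "c = from_nat_into (lists D)"
  define z where "z = weighted w (block_sequence c)"
  have growth: "norm (block_sequence c k) \<le> 1 * 2 ^ k" for k
    using norm_block_sequence_le[of c k] by simp
  have near: "\<exists>s\<in>orb (wshift w) z. N (weighted w u - s) < e"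
    if u: "\<And>k. k \<ge> m \<Longrightarrow> u k = 0" and e: "e > 0" for u m e
  proof -
    define C where "C = (\<Sum>k<m. 1 / norm (weight w k))"
    have C: "C \<ge> 0" by (simp add: C_def sum_nonneg)
    \<comment> \<open>An entrywise error of \<open>d\<close> costs at most \<open>d C\<close> in norm; adding one avoids dividing by zero.\<close>
    define d where "d = e / 2 / (C + 1)"
    have d: "d > 0" using e C by (simp add: d_def)
    obtain xs where xs: "xs \<in> lists D" "length xs = m" "\<And>k. norm (u k - word xs k) < d"
      using word_approx[of D m u d] D(2) u d by metis
    have "countable (lists D)" using D(1) by blast
    then obtain i where i: "c i = xs"
      using from_nat_into_surj[OF _ xs(1)] unfolding c_def by blast
    obtain n where n: "N (weighted w (word (c i)) - (wshift w ^^ n) z) < e / 2"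
      using block_sequence_orbit_approx[of "e / 2"] e unfolding z_def by auto
    define v where "v = weighted w (\<lambda>k. u k - word xs k)"
    have v0: "v k = 0" if "k \<ge> m" for k
      using that xs(2) u[OF that] by (simp add: v_def weighted_def word_def)
    have "N v \<le> (\<Sum>k<m. norm (v k))" by (rule finite_support(2)[OF v0])
    also have "\<dots> \<le> (\<Sum>k<m. d * (1 / norm (weight w k)))"
      using less_imp_le[OF xs(3)]
      by (intro sum_mono) (simp add: v_def weighted_def norm_divide divide_right_mono)
    also have "\<dots> = d * C" by (simp add: C_def sum_distrib_left)
    also have "\<dots> \<le> e / 2" using C e by (simp add: d_def field_simps)
    finally have Nv: "N v \<le> e / 2" .
    have "v \<in> X" by (rule finite_support(1)[OF v0])
    moreover have "weighted w (word (c i)) - (wshift w ^^ n) z \<in> X"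
    proof (rule subspace_diff[OF subspace_carrier])
      show "weighted w (word (c i)) \<in> X"
        using xs(2) i by (intro finite_support(1)[of m]) (simp add: weighted_def word_def)
      show "(wshift w ^^ n) z \<in> X"
        unfolding z_def by (rule funpow_weighted_mem[OF growth])
    qed
    ultimately have "N (v + (weighted w (word (c i)) - (wshift w ^^ n) z)) < e"
      using norm_triangle Nv n by fastforce
    then show ?thesis
      by (intro bexI[of _ "(wshift w ^^ n) z"])
        (simp_all add: v_def i orb_def flip: weighted_diff)
  qed
  have dense: "dense_in X N (orb (wshift w) z)"
  proof (rule dense_in_if_approx_finite[OF _ near])
    show "orb (wshift w) z \<subseteq> X"
      unfolding orb_def z_def using funpow_weighted_mem[OF growth] by blast
  qed
  \<comment> \<open>The orbit of zero stays at distance at least one from the first unit vector.\<close>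
  have "z \<noteq> 0"
  proof
    assume z: "z = 0"
    have "(wshift w ^^ n) 0 = 0" for n
      by (induction n) (simp_all add: wshift_def fun_eq_iff)
    then have "orb (wshift w) z = {0}" by (auto simp: z orb_def)
    then have N: "N (weighted w (\<lambda>k. if k = 0 then 1 else 0)) < 1"
      using near[of 1 "\<lambda>k. if k = 0 then 1 else 0" 1] by simp
    have "weighted w (\<lambda>k. if k = 0 then 1 else 0) \<in> X"
      by (rule weighted_mem[of _ 1 1]) simp
    from norm_coord_le[OF this, of 0] N show False
      by (simp add: weighted_def weight_def)
  qed
  moreover have "z \<in> C_infinity X (wshift_domain w X) (wshift w)"
    unfolding z_def by (rule weighted_C_infinity[OF growth])
  ultimately show ?thesis
    using dense unfolding hypercyclic_def hypercyclic_vector_def by blast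
qed

section \<open>The shift on the classical sequence spaces\<close>

theorem theorem3p1:
  shows
    "(\<forall>(w::real) X N. 1 < norm w \<and> lp_or_c0 X N \<longrightarrow>
        linear_operator_in seq_scale X (wshift_domain w X) (wshift w) \<and>
        \<not> bounded_on N (wshift_domain w X) (wshift w) \<and>
        chaotic X N (wshift_domain w X) (wshift w)) \<and>
     (\<forall>(w::complex) X N. 1 < norm w \<and> lp_or_c0 X N \<longrightarrow>
        linear_operator_in seq_scale X (wshift_domain w X) (wshift w) \<and>
        \<not> bounded_on N (wshift_domain w X) (wshift w) \<and>
        chaotic X N (wshift_domain w X) (wshift w) \<and>
        spectrum seq_scale X N (wshift_domain w X) (wshift w) = UNIV \<and>
        (\<forall>l. eigenvalue seq_scale (wshift_domain w X) (wshift w) l \<and>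
             vector_space.dim seq_scale (eigenspace seq_scale (wshift_domain w X) (wshift w) l) = 1))"
proof (intro conjI allI impI; (elim conjE)?)
  fix w :: real and X :: "(nat \<Rightarrow> real) set" and N
  assume w: "1 < norm w" and X: "lp_or_c0 X N"
  interpret wshift_on_solid X N w
    using solid_lp_or_c0[OF X] w by (simp add: wshift_on_solid_def wshift_on_solid_axioms_def)
  show "linear_operator_in seq_scale X (wshift_domain w X) (wshift w)"
    by (rule linear_operator)
  show "\<not> bounded_on N (wshift_domain w X) (wshift w)" by (rule unbounded)
  show "chaotic X N (wshift_domain w X) (wshift w)"
    using hypercyclic_wshift[OF wshift_on_solid_axioms] periodic_points_dense
    by (simp add: chaotic_def)
next
  fix w :: complex and X :: "(nat \<Rightarrow> complex) set" and N
  assume w: "1 < norm w" and X: "lp_or_c0 X N"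
  interpret wshift_on_solid X N w
    using solid_lp_or_c0[OF X] w by (simp add: wshift_on_solid_def wshift_on_solid_axioms_def)
  show "linear_operator_in seq_scale X (wshift_domain w X) (wshift w)"
    by (rule linear_operator)
  show "\<not> bounded_on N (wshift_domain w X) (wshift w)" by (rule unbounded)
  show "chaotic X N (wshift_domain w X) (wshift w)"
    using hypercyclic_wshift[OF wshift_on_solid_axioms] periodic_points_dense
    by (simp add: chaotic_def)
  show "spectrum seq_scale X N (wshift_domain w X) (wshift w) = UNIV" by (rule spectrum_eq_UNIV)
  show "eigenvalue seq_scale (wshift_domain w X) (wshift w) l" for l by (rule eigenvalue)
  show "dim (eigenspace seq_scale (wshift_domain w X) (wshift w) l) = 1" for l
    by (rule dim_eigenspace)
qed

end
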